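(* For every integer $m\ge 1$, the coefficient sequence of the polynomial $\begin{bmatrix} m+2 \\ 2 \end{bmatrix}_{\mathcal{F}}$ (in the variable $q$) is symmetric and unimodal.
   Context: $F_n$ denotes the Fibonacci numbers: $F_0=0$, $F_1=1$, $F_n=F_{n-1}+F_{n-2}$ for $n\ge 2$. For a positive integer $n$, $[n]_q := 1+q+\dots+q^{n-1}$, and $[F_n]^!_q := \prod_{k=1}^n [F_k]_q$. For positive integers $m,n$, the $q$-Fibonomial coefficient is $$\begin{bmatrix} m+n \\ n \end{bmatrix}_{\mathcal{F}} := \frac{[F_{m+n}]^!_q}{[F_m]^!_q\,[F_n]^!_q},$$ known to be a polynomial in $q$. A polynomial $\sum_{k=0}^N c_k q^k$ of degree $N$ is symmetric if $c_k=c_{N-k}$ for all $k$, and unimodal if there is an $M$ with $c_0\le c_1\le\dots\le c_{M-1}\le c_M\ge c_{M+1}\ge\dots\ge c_N$. *)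

theory Defs
  imports "HOL-Computational_Algebra.Polynomial" "HOL-Number_Theory.Fib"
begin

definition q_int :: "nat \<Rightarrow> int poly" where
  "q_int n = (\<Sum>i<n. monom 1 i)"

definition q_fib_fact :: "nat \<Rightarrow> int poly" where
  "q_fib_fact n = (\<Prod>k = 1..n. q_int (fib k))"

text \<open>
  The \<open>q\<close>-Fibonomial coefficient with top entry \<open>m + n\<close> and bottom entry \<open>n\<close>.
  The division of integer polynomials is exact, see \<open>q_fibonomial_mult\<close> below, so
  this is the quotient in the field of rational functions.
\<close>

definition q_fibonomial :: "nat \<Rightarrow> nat \<Rightarrow> int poly" where
  "q_fibonomial m n = q_fib_fact (m + n) div (q_fib_fact m * q_fib_fact n)"

definition symmetric_poly :: "int poly \<Rightarrow> bool" where
  "symmetric_poly p \<longleftrightarrow> (\<forall>k \<le> degree p. coeff p k = coeff p (degree p - k))"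

definition unimodal_poly :: "int poly \<Rightarrow> bool" where
  "unimodal_poly p \<longleftrightarrow> (\<exists>M \<le> degree p.
     (\<forall>k < M. coeff p k \<le> coeff p (Suc k)) \<and>
     (\<forall>k. M \<le> k \<and> k < degree p \<longrightarrow> coeff p (Suc k) \<le> coeff p k))"

lemma q_int_add: "q_int (a + b) = q_int a + monom 1 a * q_int b"
  by (induction b) (simp_all add: q_int_def mult_monom algebra_simps)

lemma q_int_dvd_mult: "q_int a dvd q_int (a * b)"
  by (induction b) (simp_all add: q_int_add, simp add: q_int_def)

lemma q_int_nonzero: "n > 0 \<Longrightarrow> q_int n \<noteq> 0"
proof -
  assume "n > 0"
  have "coeff (q_int n) 0 = (\<Sum>i<n. if i = 0 then 1 else 0)"
    by (simp add: q_int_def coeff_sum)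
  also have "\<dots> = 1"
    using \<open>n > 0\<close> by (simp add: sum.delta)
  finally show ?thesis by auto
qed

lemma q_fib_fact_nonzero: "q_fib_fact n \<noteq> 0"
  by (auto simp: q_fib_fact_def q_int_nonzero fib_neq_0_nat)

lemma q_fib_fact_Suc: "q_fib_fact (Suc n) = q_fib_fact n * q_int (fib (Suc n))"
  by (simp add: q_fib_fact_def)

lemma q_fib_fact_dvd: "q_fib_fact m * q_fib_fact n dvd q_fib_fact (m + n)"
proof (induction "m + n" arbitrary: m n)
  case 0
  then show ?case by (simp add: q_fib_fact_def)
next
  case (Suc s)
  show ?case
  proof (cases "m = 0 \<or> n = 0")
    case True
    then show ?thesis by (auto simp: q_fib_fact_def)
  next
    case False
    then obtain a b where ab: "m = Suc a" "n = Suc b"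
      by (metis not0_implies_Suc)
    let ?T = "q_fib_fact (Suc (a + b))"
    have "fib (m + n) = fib n * fib (Suc m) + fib m * fib b"
      using fib_add[of m b] by (simp add: ab mult.commute)
    then have "q_int (fib (m + n)) = q_int (fib n * fib (Suc m))
        + monom 1 (fib n * fib (Suc m)) * q_int (fib m * fib b)"
      by (simp only: q_int_add)
    moreover obtain A where "q_int (fib n * fib (Suc m)) = q_int (fib n) * A"
      using q_int_dvd_mult by blast
    moreover obtain B where "q_int (fib m * fib b) = q_int (fib m) * B"
      using q_int_dvd_mult by blast
    ultimately have split: "q_fib_fact (m + n) = (?T * q_int (fib n)) * A
        + (?T * q_int (fib m)) * (monom 1 (fib n * fib (Suc m)) * B)"
      using q_fib_fact_Suc[of "Suc (a + b)"] by (simp add: ab algebra_simps)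
    have "q_fib_fact m * q_fib_fact b dvd ?T"
      using Suc(1)[of m b] Suc(2) by (simp add: ab)
    then have 1: "q_fib_fact m * q_fib_fact n dvd ?T * q_int (fib n)"
      using mult_dvd_mono[OF _ dvd_refl[of "q_int (fib n)"]]
      by (simp only: ab q_fib_fact_Suc mult.assoc[symmetric])
    have "q_fib_fact a * q_fib_fact n dvd ?T"
      using Suc(1)[of a n] Suc(2) by (simp add: ab)
    then have "(q_fib_fact a * q_fib_fact n) * q_int (fib m) dvd ?T * q_int (fib m)"
      by (rule mult_dvd_mono) simp
    then have 2: "q_fib_fact m * q_fib_fact n dvd ?T * q_int (fib m)"
      by (simp only: ab q_fib_fact_Suc mult_ac)
    show ?thesis
      unfolding split by (rule dvd_add[OF dvd_mult2[OF 1] dvd_mult2[OF 2]])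
  qed
qed

lemma q_fibonomial_mult:
  "q_fibonomial m n * (q_fib_fact m * q_fib_fact n) = q_fib_fact (m + n)"
  using q_fib_fact_dvd[of m n] q_fib_fact_nonzero[of m] q_fib_fact_nonzero[of n]
  by (auto simp: q_fibonomial_def elim!: dvdE)

end

theory Submission
  imports Defs
begin

text \<open>
  Since \<open>F\<^sub>1 = F\<^sub>2 = 1\<close>, the denominator contributes only \<open>[F\<^sub>m]!\<close>, and the quotient is the
  product \<open>[F\<^sub>m\<^sub>+\<^sub>1] [F\<^sub>m\<^sub>+\<^sub>2]\<close> of two \<open>q\<close>-integers.  For all positive \<open>a\<close> and \<open>b\<close>, the coefficient
  sequence of \<open>[a] [b]\<close> is a trapezoid: it climbs by steps of one, stays at \<open>min a b\<close> and falls
  by steps of one, because its \<open>k\<close>-th entry counts the lattice points of an \<open>a\<close> by \<open>b\<close> rectangle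
  on the antidiagonal \<open>i + j = k\<close>.  The closed form \<open>coeff_q_int_mult\<close> of this count
  gives degree, symmetry and unimodality by linear arithmetic.
\<close>

lemma coeff_q_int: "coeff (q_int n) k = (if k < n then 1 else 0)"
  by (simp add: q_int_def coeff_sum sum.delta)

text \<open>
  A pair \<open>(i, k - i)\<close> lies in the rectangle iff \<open>k + 1 - b \<le> i < min (k + 1) a\<close>.  Both
  subtractions of naturals truncate: the inner one gives the bound \<open>0\<close> while \<open>k < b\<close>, the outer
  one the value \<open>0\<close> once the antidiagonal has left the rectangle.
\<close>

lemma coeff_q_int_mult:
  assumes "b > 0"
  shows "coeff (q_int a * q_int b) k = int (min (k + 1) a - (k + 1 - b))"
proof -
  have "coeff (q_int a * q_int b) k = (\<Sum>i\<le>k. if i < a \<and> k - i < b then 1 else 0)"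
    unfolding coeff_mult by (intro sum.cong) (auto simp: coeff_q_int)
  also have "\<dots> = int (card {i \<in> {..k}. i < a \<and> k - i < b})"
    by (simp add: sum.inter_filter[symmetric])
  also have "{i \<in> {..k}. i < a \<and> k - i < b} = {k + 1 - b..<min (k + 1) a}"
    using assms by auto
  finally show ?thesis by simp
qed

lemma degree_q_int_mult:
  assumes "a > 0" "b > 0"
  shows "degree (q_int a * q_int b) = a + b - 2"
proof (rule antisym)
  show "degree (q_int a * q_int b) \<le> a + b - 2"
    using assms by (intro degree_le) (auto simp: coeff_q_int_mult)
  show "a + b - 2 \<le> degree (q_int a * q_int b)"
    using assms by (intro le_degree) (auto simp: coeff_q_int_mult)
qed

lemma symmetric_poly_q_int_mult:
  assumes "a > 0" "b > 0"
  shows "symmetric_poly (q_int a * q_int b)"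
  unfolding symmetric_poly_def degree_q_int_mult[OF assms] coeff_q_int_mult[OF assms(2)]
  using assms by (auto simp: min_def)

lemma unimodal_poly_q_int_mult:
  assumes "a > 0" "b > 0"
  shows "unimodal_poly (q_int a * q_int b)"
  unfolding unimodal_poly_def degree_q_int_mult[OF assms] coeff_q_int_mult[OF assms(2)]
  \<comment> \<open>The peak is the left end of the plateau of the trapezoid.\<close>
  using assms by (intro exI[of _ "min a b - 1"]) (auto simp: min_def)

lemma q_fibonomial_2: "q_fibonomial m 2 = q_int (fib (m + 1)) * q_int (fib (m + 2))"
proof -
  have "q_int (Suc 0) = 1"
    by (simp add: q_int_def)
  then have "q_fib_fact 2 = 1"
    by (simp add: q_fib_fact_def numeral_2_eq_2)
  then have "q_fibonomial m 2 * q_fib_fact m = q_fib_fact (m + 2)"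
    using q_fibonomial_mult[of m 2] by simp
  also have "\<dots> = (q_int (fib (m + 1)) * q_int (fib (m + 2))) * q_fib_fact m"
    by (simp add: q_fib_fact_Suc mult_ac del: fib.simps)
  finally show ?thesis
    using q_fib_fact_nonzero[of m] by simp
qed

theorem corollary3p12:
  fixes m :: nat
  assumes "m \<ge> 1"
  shows "symmetric_poly (q_fibonomial m 2) \<and> unimodal_poly (q_fibonomial m 2)"
  unfolding q_fibonomial_2
  by (intro conjI symmetric_poly_q_int_mult unimodal_poly_q_int_mult)
    (simp_all add: fib_neq_0_nat)

end
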